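(* Let $a,b$ be integers with $b\ge 1$ and $b\le a\le 2b$. Then there is a graph $G$ with $n$ vertices and $m$ edges such that $\frac{m}{n}=\frac{a}{b}$ and $\psi_3(G)\ge \frac{2n+m}{6}$.
   Context: Graphs are finite and simple. A subset $S\subseteq V(G)$ is a $3$-path vertex cover of $G$ if every path on $3$ vertices in $G$ contains at least one vertex of $S$; $\psi_3(G)$ denotes the minimum cardinality of a $3$-path vertex cover of $G$. *)

theory Defs
  imports Complex_Main
begin

definition fin_simple_graph :: "'a set \<Rightarrow> 'a set set \<Rightarrow> bool" where
  "fin_simple_graph V E \<longleftrightarrow> finite V \<and> (\<forall>e\<in>E. e \<subseteq> V \<and> card e = 2)"

(* A path is a subgraph, not necessarily induced, so chords are allowed. *)
definition is_path :: "'a set \<Rightarrow> 'a set set \<Rightarrow> 'a list \<Rightarrow> bool" where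
  "is_path V E p \<longleftrightarrow>
     p \<noteq> [] \<and> set p \<subseteq> V \<and> distinct p \<and> successively (\<lambda>u v. {u, v} \<in> E) p"

definition three_path_vertex_cover :: "'a set \<Rightarrow> 'a set set \<Rightarrow> 'a set \<Rightarrow> bool" where
  "three_path_vertex_cover V E S \<longleftrightarrow>
     S \<subseteq> V \<and> (\<forall>p. is_path V E p \<and> length p = 3 \<longrightarrow> set p \<inter> S \<noteq> {})"

(* For finite V the set below is finite, and it is nonempty because V itself is a cover. *)
definition psi3 :: "'a set \<Rightarrow> 'a set set \<Rightarrow> nat" where
  "psi3 V E = Min (card ` {S. three_path_vertex_cover V E S})"

end

(* Every subset of three vertices of the complete graph minus a perfect matching still spans a path on
   three vertices, so a cover of this graph misses at most two vertices. On 4 vertices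
   (the 4-cycle, density 1) and on 6 vertices (the octahedron, density 2) the bound
   (2n + m) / 6 is attained. Both sides of it are additive over disjoint unions, and 3(2b - a)
   four-cycles together with 2(a - b) octahedra have 12b vertices and 12a edges. *)
theory Submission
  imports Defs
begin

text \<open>Replaces lists by triples. Edges are two-element subsets of V, so they already place x,
  y, z in V and separate neighbours; of distinctness only \<open>x \<noteq> z\<close> is left to ask
  for.\<close>

lemma three_path_vertex_cover_iff:
  assumes "fin_simple_graph V E"
  shows "three_path_vertex_cover V E S \<longleftrightarrow>
    S \<subseteq> V \<and> (\<forall>x y z. x \<noteq> z \<longrightarrow> {x, y} \<in> E \<longrightarrow> {y, z} \<in> E \<longrightarrow> x \<in> S \<or> y \<in> S \<or> z \<in> S)"
    (is "_ \<longleftrightarrow> _ \<and> ?Q")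
proof -
  have edge: "u \<in> V \<and> v \<in> V \<and> u \<noteq> v" if "{u, v} \<in> E" for u v
    using assms that unfolding fin_simple_graph_def by force
  have path: "is_path V E [x, y, z] \<longleftrightarrow> x \<noteq> z \<and> {x, y} \<in> E \<and> {y, z} \<in> E" for x y z
    using edge by (auto simp: is_path_def)
  have "(\<forall>p. is_path V E p \<and> length p = 3 \<longrightarrow> set p \<inter> S \<noteq> {}) \<longleftrightarrow>
      (\<forall>x y z. is_path V E [x, y, z] \<longrightarrow> set [x, y, z] \<inter> S \<noteq> {})"
    by (auto simp: numeral_3_eq_3 length_Suc_conv) blast
  also have "\<dots> \<longleftrightarrow> ?Q"
    by (simp only: path) auto
  finally show ?thesis
    by (simp add: three_path_vertex_cover_def)
qed

lemma fin_simple_graph_finite_edges: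
  assumes "fin_simple_graph V E"
  shows "finite E"
  using assms finite_subset[of E "Pow V"] by (auto simp: fin_simple_graph_def)

lemma psi3_ge:
  assumes "finite V" and "\<And>S. three_path_vertex_cover V E S \<Longrightarrow> k \<le> card S"
  shows "k \<le> psi3 V E"
proof -
  have "three_path_vertex_cover V E V"
    by (auto simp: three_path_vertex_cover_def is_path_def Int_absorb2)
  moreover have "finite {S. three_path_vertex_cover V E S}"
    using assms(1) finite_subset[of _ "Pow V"] by (auto simp: three_path_vertex_cover_def)
  ultimately show ?thesis
    unfolding psi3_def using assms(2) by (subst Min_ge_iff) auto
qed

text \<open>The bound is required of every cover and cleared of its denominator, so that it can be
  transported and added in the naturals without handling a minimum.\<close>

definition cover_heavy :: "'a set \<Rightarrow> 'a set set \<Rightarrow> bool" where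
  "cover_heavy V E \<longleftrightarrow> fin_simple_graph V E \<and>
     (\<forall>S. three_path_vertex_cover V E S \<longrightarrow> 2 * card V + card E \<le> 6 * card S)"

lemma cover_heavy_psi3:
  assumes "cover_heavy V E"
  shows "(2 * real (card V) + real (card E)) / 6 \<le> real (psi3 V E)"
proof -
  \<comment> \<open>Adding 5 before dividing gives the ceiling of (2n + m) / 6, a natural number as
    \<open>psi3_ge\<close> demands.\<close>
  have "(2 * card V + card E + 5) div 6 \<le> psi3 V E"
    by (rule psi3_ge) (use assms in \<open>fastforce simp: cover_heavy_def fin_simple_graph_def\<close>)+
  then have "2 * card V + card E \<le> 6 * psi3 V E"
    by linarith
  then have "real (2 * card V + card E) \<le> real (6 * psi3 V E)"
    by (simp only: of_nat_le_iff)
  then show ?thesis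
    by simp
qed

text \<open>Serves to move graphs on the same vertex type apart. A cover S of the image lies in the
  range of f, so its preimage is a cover of the original graph with equally many vertices.\<close>

lemma cover_heavy_image:
  assumes "inj f" and "cover_heavy V E"
  shows "cover_heavy (f ` V) ((`) f ` E)"
    and "card ((`) f ` E) = card E"
proof -
  have graph: "fin_simple_graph V E"
    using assms(2) by (simp add: cover_heavy_def)
  have graph': "fin_simple_graph (f ` V) ((`) f ` E)"
    using graph assms(1) by (auto simp: fin_simple_graph_def card_image inj_on_subset)
  show card_E: "card ((`) f ` E) = card E"
    using assms(1) by (intro card_image inj_onI) (simp add: inj_image_eq_iff)
  have "2 * card V + card E \<le> 6 * card S"
    if cover: "three_path_vertex_cover (f ` V) ((`) f ` E) S" for S
  proof -
    have S: "S \<subseteq> f ` V"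
      using cover by (simp add: three_path_vertex_cover_def)
    have "f x \<in> S \<or> f y \<in> S \<or> f z \<in> S" if "x \<noteq> z" "{x, y} \<in> E" "{y, z} \<in> E" for x y z
    proof -
      have "{f x, f y} \<in> (`) f ` E" "{f y, f z} \<in> (`) f ` E" "f x \<noteq> f z"
        using that assms(1) by (auto intro: rev_image_eqI dest: injD)
      then show ?thesis
        using cover unfolding three_path_vertex_cover_iff[OF graph'] by blast
    qed
    moreover have "f -` S \<subseteq> V"
      using S assms(1) by (auto dest: injD)
    ultimately have "three_path_vertex_cover V E (f -` S)"
      unfolding three_path_vertex_cover_iff[OF graph] by auto
    moreover have "card (f -` S) = card S"
      using S assms(1) by (intro card_vimage_inj) auto
    ultimately show ?thesis
      using assms(2) unfolding cover_heavy_def by metis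
  qed
  moreover have "card (f ` V) = card V"
    using assms(1) by (intro card_image) (auto intro: inj_on_subset)
  ultimately show "cover_heavy (f ` V) ((`) f ` E)"
    using graph' card_E by (simp add: cover_heavy_def)
qed

text \<open>A cover S of the union meets V and W in covers of the two parts, and their sizes add up
  to that of S. A common edge would have its two vertices in the empty set
  \<open>V \<inter> W\<close>.\<close>

lemma cover_heavy_disjoint_Un:
  assumes "cover_heavy V E" and "cover_heavy W F" and "V \<inter> W = {}"
  shows "cover_heavy (V \<union> W) (E \<union> F)"
    and "card (E \<union> F) = card E + card F"
proof -
  have gE: "fin_simple_graph V E" and gF: "fin_simple_graph W F"
    using assms by (simp_all add: cover_heavy_def)
  then have g: "fin_simple_graph (V \<union> W) (E \<union> F)"
    by (auto simp: fin_simple_graph_def)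
  have "e \<notin> F" if "e \<in> E" for e
  proof
    assume "e \<in> F"
    then have "e \<subseteq> V \<inter> W" "card e = 2"
      using that gE gF by (auto simp: fin_simple_graph_def)
    then show False
      using assms(3) by auto
  qed
  then show card_EF: "card (E \<union> F) = card E + card F"
    using gE gF by (intro card_Un_disjoint) (auto dest: fin_simple_graph_finite_edges)
  have fin: "finite V" "finite W"
    using gE gF by (auto simp: fin_simple_graph_def)
  have "2 * card (V \<union> W) + card (E \<union> F) \<le> 6 * card S"
    if cover: "three_path_vertex_cover (V \<union> W) (E \<union> F) S" for S
  proof -
    have S: "S \<subseteq> V \<union> W"
      using cover by (simp add: three_path_vertex_cover_def)
    have endpoints: "u \<in> V \<and> v \<in> V" if "{u, v} \<in> E" for u v
      using gE that unfolding fin_simple_graph_def by blast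
    have endpoints': "u \<in> W \<and> v \<in> W" if "{u, v} \<in> F" for u v
      using gF that unfolding fin_simple_graph_def by blast
    have "three_path_vertex_cover V E (S \<inter> V)"
      using cover endpoints
      unfolding three_path_vertex_cover_iff[OF gE] three_path_vertex_cover_iff[OF g] by blast
    moreover have "three_path_vertex_cover W F (S \<inter> W)"
      using cover endpoints'
      unfolding three_path_vertex_cover_iff[OF gF] three_path_vertex_cover_iff[OF g] by blast
    ultimately have "2 * card V + card E \<le> 6 * card (S \<inter> V)"
      "2 * card W + card F \<le> 6 * card (S \<inter> W)"
      using assms by (auto simp: cover_heavy_def)
    moreover have "card S = card (S \<inter> V) + card (S \<inter> W)"
    proof -
      have "S = (S \<inter> V) \<union> (S \<inter> W)"
        using S by blast
      then have "card S = card ((S \<inter> V) \<union> (S \<inter> W))"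
        by simp
      also have "\<dots> = card (S \<inter> V) + card (S \<inter> W)"
        using fin assms(3) by (intro card_Un_disjoint) auto
      finally show ?thesis .
    qed
    moreover have "card (V \<union> W) = card V + card W"
      using fin assms(3) by (rule card_Un_disjoint)
    ultimately show ?thesis
      using card_EF by linarith
  qed
  then show "cover_heavy (V \<union> W) (E \<union> F)"
    using g by (simp add: cover_heavy_def)
qed

text \<open>Any two of the three pairs inside a triple share a vertex, so at most one of them lies
  in M. The other two are edges and form a path, hence S cannot miss three vertices.\<close>

lemma cover_complete_minus_matching:
  assumes "finite V" and matching: "pairwise disjnt M"
    and cover: "three_path_vertex_cover V ({e. e \<subseteq> V \<and> card e = 2} - M) S"
  shows "card V \<le> card S + 2"
proof (rule ccontr)
  assume "\<not> card V \<le> card S + 2"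
  moreover have S: "S \<subseteq> V"
    using cover by (simp add: three_path_vertex_cover_def)
  ultimately have "3 \<le> card (V - S)"
    using assms(1) by (simp add: card_Diff_subset finite_subset)
  then obtain T where "T \<subseteq> V - S" "card T = 3"
    by (rule obtain_subset_with_card_n)
  then obtain x y z where T: "x \<in> V - S" "y \<in> V - S" "z \<in> V - S" "x \<noteq> y" "y \<noteq> z" "x \<noteq> z"
    by (auto simp: card_3_iff)
  have graph: "fin_simple_graph V ({e. e \<subseteq> V \<and> card e = 2} - M)"
    using assms(1) by (simp add: fin_simple_graph_def)
  have bad: "{u, v} \<in> M \<or> {v, w} \<in> M"
    if "u \<in> V - S" "v \<in> V - S" "w \<in> V - S" "u \<noteq> v" "v \<noteq> w" "u \<noteq> w" for u v w
    using cover that unfolding three_path_vertex_cover_iff[OF graph] by force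
  have single: "\<not> ({u, v} \<in> M \<and> {v, w} \<in> M)" if "u \<noteq> v" "v \<noteq> w" "u \<noteq> w" for u v w
    using matching that unfolding pairwise_def disjnt_def by (force simp: doubleton_eq_iff)
  \<comment> \<open>The rotations of \<open>bad\<close> force at least two of the three pairs into
    M, while those of \<open>single\<close> allow at most one.\<close>
  show False
    using bad[of x y z] bad[of y z x] bad[of z x y] single[of x y z] single[of y z x] single[of z x y] T
    by (auto simp: insert_commute)
qed

text \<open>The cocktail party graph: the 4-cycle for k = 2, the octahedron for k = 3.\<close>

definition cocktail_edges :: "nat \<Rightarrow> nat set set" where
  "cocktail_edges k = {e. e \<subseteq> {..<2 * k} \<and> card e = 2} - (\<lambda>i. {2 * i, 2 * i + 1}) ` {..<k}"

lemma card_cocktail_edges: "card (cocktail_edges k) = (2 * k choose 2) - k"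
proof -
  let ?M = "(\<lambda>i. {2 * i, 2 * i + 1}) ` {..<k}"
  have "inj_on (\<lambda>i::nat. {2 * i, 2 * i + 1}) {..<k}"
    by (rule inj_onI) (auto simp: doubleton_eq_iff)
  then have "card ?M = k"
    by (simp add: card_image)
  moreover have "?M \<subseteq> {e. e \<subseteq> {..<2 * k} \<and> card e = 2}"
    by auto
  ultimately show ?thesis
    by (simp add: cocktail_edges_def card_Diff_subset n_subsets)
qed

lemma cover_heavy_cocktail:
  assumes "k = 2 \<or> k = 3"
  shows "cover_heavy {..<2 * k} (cocktail_edges k)"
proof -
  have "pairwise disjnt ((\<lambda>i::nat. {2 * i, 2 * i + 1}) ` {..<k})"
    by (auto simp: pairwise_def disjnt_def double_not_eq_Suc_double Suc_double_not_eq_double)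
  then have cover: "2 * k \<le> card S + 2"
    if "three_path_vertex_cover {..<2 * k} (cocktail_edges k) S" for S
    using cover_complete_minus_matching[of "{..<2 * k}" _ S] that by (simp add: cocktail_edges_def)
  \<comment> \<open>With 2k(k - 1) edges and k \<ge> 1 this amounts to (k - 2)(k - 3) \<le> 0,
    whence the choice of 2 and 3; both give equality.\<close>
  have "2 * (2 * k) + card (cocktail_edges k) \<le> 6 * (2 * k - 2)"
    using assms by (auto simp: card_cocktail_edges choose_two)
  then have "2 * (2 * k) + card (cocktail_edges k) \<le> 6 * card S"
    if "three_path_vertex_cover {..<2 * k} (cocktail_edges k) S" for S
    using cover[OF that] by linarith
  moreover have "fin_simple_graph {..<2 * k} (cocktail_edges k)"
    by (auto simp: fin_simple_graph_def cocktail_edges_def)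
  ultimately show ?thesis
    by (simp add: cover_heavy_def)
qed

text \<open>Keeps only the two counts, which hides all relabelling. With natural numbers as
  vertices, disjoint copies always fit into the same type.\<close>

definition heavy_pair :: "nat \<Rightarrow> nat \<Rightarrow> bool" where
  "heavy_pair n m \<longleftrightarrow> (\<exists>(V :: nat set) E. cover_heavy V E \<and> card V = n \<and> card E = m)"

lemma heavy_pair_cocktail:
  assumes "k = 2 \<or> k = 3"
  shows "heavy_pair (2 * k) ((2 * k choose 2) - k)"
  unfolding heavy_pair_def using cover_heavy_cocktail[OF assms] card_cocktail_edges[of k]
  by (metis card_lessThan)

text \<open>Base case for multiples. Zero copies do occur: a = b uses no octahedron and a = 2b no
  four-cycle.\<close>

lemma heavy_pair_0: "heavy_pair 0 0"
  unfolding heavy_pair_def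
  by (rule exI[of _ "{}"], rule exI[of _ "{}"]) (simp add: cover_heavy_def fin_simple_graph_def)

lemma heavy_pair_add:
  assumes "heavy_pair n m" and "heavy_pair n' m'"
  shows "heavy_pair (n + n') (m + m')"
proof -
  obtain V W :: "nat set" and E F
    where V: "cover_heavy V E" "card V = n" "card E = m"
      and W: "cover_heavy W F" "card W = n'" "card F = m'"
    using assms by (auto simp: heavy_pair_def)
  \<comment> \<open>Even and odd numbers keep the two copies disjoint.\<close>
  define f g :: "nat \<Rightarrow> nat" where "f = (\<lambda>i. 2 * i)" and "g = (\<lambda>i. 2 * i + 1)"
  have inj: "inj f" "inj g"
    by (auto simp: f_def g_def inj_def)
  have disj: "f ` V \<inter> g ` W = {}"
    by (auto simp: f_def g_def) presburger
  note heavy = cover_heavy_image[OF inj(1) V(1)] cover_heavy_image[OF inj(2) W(1)]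
  note union = cover_heavy_disjoint_Un[OF heavy(1) heavy(3) disj]
  have "card (f ` V \<union> g ` W) = card (f ` V) + card (g ` W)"
    using heavy(1,3) disj by (intro card_Un_disjoint) (auto simp: cover_heavy_def fin_simple_graph_def)
  also have "\<dots> = n + n'"
    using inj V(2) W(2) by (metis card_image inj_on_subset subset_UNIV)
  finally show ?thesis
    using union heavy(2,4) V(3) W(3) unfolding heavy_pair_def by metis
qed

lemma heavy_pair_mult:
  assumes "heavy_pair n m"
  shows "heavy_pair (k * n) (k * m)"
  by (induction k) (auto intro: heavy_pair_0 heavy_pair_add assms)

theorem theorem8:
  fixes a b :: int
  assumes "b \<ge> 1" and "b \<le> a" and "a \<le> 2 * b"
  shows "\<exists>(V :: nat set) (E :: nat set set).
           fin_simple_graph V E \<and> V \<noteq> {} \<and>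
           real (card E) / real (card V) = real_of_int a / real_of_int b \<and>
           real (psi3 V E) \<ge> (2 * real (card V) + real (card E)) / 6"
proof -
  \<comment> \<open>Density a/b mixes densities 1 and 2 with vertex weights 2b - a and a - b, both
    nonnegative by assumption. Scaling by 12, the least common multiple of 4 and 6, makes both
    numbers of copies integers.\<close>
  define x y where "x = nat (3 * (2 * b - a))" and "y = nat (2 * (a - b))"
  have "heavy_pair 4 4" "heavy_pair 6 12"
    using heavy_pair_cocktail[of 2] heavy_pair_cocktail[of 3] by (simp_all add: choose_two)
  then have "heavy_pair (x * 4 + y * 6) (x * 4 + y * 12)"
    by (intro heavy_pair_add heavy_pair_mult)
  moreover have "x * 4 + y * 6 = nat (12 * b)" "x * 4 + y * 12 = nat (12 * a)"
    using assms by (auto simp: x_def y_def)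
  ultimately obtain V :: "nat set" and E
    where VE: "cover_heavy V E" "card V = nat (12 * b)" "card E = nat (12 * a)"
    by (auto simp: heavy_pair_def)
  have "fin_simple_graph V E"
    using VE(1) by (simp add: cover_heavy_def)
  moreover have "V \<noteq> {}"
    using VE(2) assms(1) by auto
  moreover have "real (card E) / real (card V) = real_of_int a / real_of_int b"
    using VE(2,3) assms by simp
  ultimately show ?thesis
    using cover_heavy_psi3[OF VE(1)] by blast
qed

end
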